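(* Let $A:\mathcal{H}\to 2^{\mathcal{H}}$ be maximally monotone, let $u,x_0\in\mathcal{H}$, let $(e_k)_{k\in\mathbb{N}}$ be a sequence in $\mathcal{H}$, let $(c_k)_{k\in\mathbb{N}}$ be a sequence of strictly positive reals, let $(\alpha_k)_{k\in\mathbb{N}},(\beta_k)_{k\in\mathbb{N}},(\gamma_k)_{k\in\mathbb{N}},(\delta_k)_{k\in\mathbb{N}}$ be sequences in $\mathbb{R}$, and let $(x_k)_{k\in\mathbb{N}}$ be generated by $$(\forall k\in\mathbb{N})\quad x_{k+1}=\alpha_k u+\beta_k x_k+\gamma_k J_{c_kA}(x_k)+\delta_k e_k .$$ Suppose that $(\forall k\in\mathbb{N})$ $\left|\beta_k+\frac{\gamma_k}{2}\right|+\left|\frac{\gamma_k}{2}\right|\le 1$, that $\sum_{k\in\mathbb{N}}|\alpha_k|<\infty$, $\sum_{k\in\mathbb{N}}|1-\beta_k-\gamma_k|<\infty$, and $\sum_{k\in\mathbb{N}}\|\delta_k e_k\|<\infty$, and that one of the following holds. (i) $\gamma_k\to 1$, and [$\inf_{k\in\mathbb{N}}c_k>0$ or $c_k\to\infty$]. (ii) $(\forall k\in\mathbb{N})$ $\gamma_k(\beta_k+\gamma_k)\ge 0$; $\liminf_{k\to\infty}\gamma_k(2\beta_k+\gamma_k)>0$; [$\inf_{k\in\mathbb{N}}c_k>0$ or $c_k\to\infty$]; $\liminf_{k\to\infty}|\gamma_k|>0$; and $\sup_{k\in\mathbb{N}}|\beta_k|<\infty$. (iii) $(\forall k\in\mathbb{N})$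 $\gamma_k(\beta_k+\gamma_k)\ge 0$, $\gamma_k(2\beta_k+\gamma_k)\ge 0$, and $|\beta_k+\gamma_k|\,|\gamma_k|\le\max\left\{1-|\beta_k|,\ 2-2\left|\beta_k+\frac{\gamma_k}{2}\right|\right\}$; $\sum_{k\in\mathbb{N}}\gamma_k(2\beta_k+\gamma_k)=\infty$; $\inf_{k\in\mathbb{N}}c_k>0$ and $\sum_{k\in\mathbb{N}}|c_{k+1}-c_k|<\infty$; $\liminf_{k\to\infty}|\gamma_k|>0$; and $\sup_{k\in\mathbb{N}}|\beta_k|<\infty$. Then $\operatorname{zer}A\ne\varnothing$ if and only if $(x_k)_{k\in\mathbb{N}}$ is bounded.
   Context: $\mathcal{H}\neq\{0\}$ is a real Hilbert space with inner product $\langle\cdot,\cdot\rangle$ and induced norm $\|\cdot\|$; $\mathbb{N}=\{0,1,2,\ldots\}$. A set-valued operator $A:\mathcal{H}\to 2^{\mathcal{H}}$ has graph $\operatorname{gra}A=\{(x,w): w\in A(x)\}$; it is monotone if $\langle x-y,w-v\rangle\ge 0$ for all $(x,w),(y,v)\in\operatorname{gra}A$, and maximally monotone if moreover no monotone operator has a graph properly containing $\operatorname{gra}A$. $\operatorname{zer}A=\{x\in\mathcal{H}: 0\in A(x)\}$. For $c>0$, $J_{cA}=(\mathrm{Id}+cA)^{-1}$ is the resolvent of $cA$; for $A$ maximally monotone it is a single-valued map defined on all of $\mathcal{H}$. *)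

theory Defs
  imports "HOL-Analysis.Analysis"
begin

text \<open>
  A set-valued operator on \<open>\<H>\<close> is a function of type \<^typ>\<open>'a \<Rightarrow> 'a set\<close>, and a real Hilbert
  space is a type of sort \<open>{real_inner, banach}\<close>.
\<close>

definition gra :: "('a \<Rightarrow> 'b set) \<Rightarrow> ('a \<times> 'b) set" where
  "gra A = {(x, w). w \<in> A x}"

definition monotone_op :: "('a::real_inner \<Rightarrow> 'a set) \<Rightarrow> bool" where
  "monotone_op A \<longleftrightarrow> (\<forall>(x, w) \<in> gra A. \<forall>(y, v) \<in> gra A. (x - y) \<bullet> (w - v) \<ge> 0)"

definition maximally_monotone :: "('a::real_inner \<Rightarrow> 'a set) \<Rightarrow> bool" where
  "maximally_monotone A \<longleftrightarrow>
     monotone_op A \<and> \<not> (\<exists>B :: 'a \<Rightarrow> 'a set. monotone_op B \<and> gra A \<subset> gra B)"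

definition zer :: "('a \<Rightarrow> 'b::zero set) \<Rightarrow> 'a set" where
  "zer A = {x. 0 \<in> A x}"

definition inverse_op :: "('a \<Rightarrow> 'b set) \<Rightarrow> 'b \<Rightarrow> 'a set" where
  "inverse_op A w = {x. w \<in> A x}"

definition resolvent_op :: "real \<Rightarrow> ('a::real_vector \<Rightarrow> 'a set) \<Rightarrow> 'a \<Rightarrow> 'a set" where
  "resolvent_op c A = inverse_op (\<lambda>x. {x + c *\<^sub>R w | w. w \<in> A x})"

text \<open>
  The point-valued resolvent \<open>J\<^bsub>cA\<^esub>\<close>. For \<open>A\<close> maximally monotone and \<open>c > 0\<close>, every value of
  \<^const>\<open>resolvent_op\<close> is a singleton (Minty's theorem); otherwise \<^const>\<open>the_elem\<close> may be
  unspecified.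
\<close>

definition resolvent :: "real \<Rightarrow> ('a::real_vector \<Rightarrow> 'a set) \<Rightarrow> 'a \<Rightarrow> 'a" where
  "resolvent c A x = the_elem (resolvent_op c A x)"

end

theory Submission
  imports Defs
begin

text \<open>
  Write \<open>y k\<close> for the resolvent value at \<open>x k\<close> and \<open>w k = (x k - y k) / c k\<close>, so that
  \<open>w k \<in> A (y k)\<close>. If \<open>p\<close> is a zero of \<open>A\<close>, monotonicity gives \<open>(y k - p) \<bullet> w k \<ge> 0\<close>, which
  makes the unperturbed step nonexpansive relative to \<open>p\<close> (\<open>relaxed_step_nonexpansive\<close>); the
  perturbations are summable, so the orbit is bounded.

  For the converse the same inequality \<open>(y k - p) \<bullet> w k \<ge> 0\<close> is available without a zero. The
  points \<open>(y k, w k)\<close> with \<open>k\<close> large form a monotone set with bounded first components, and such a set always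
  has a virtual zero \<open>p\<close> satisfying the inequality for all of its points
  (\<open>bounded_monotone_set_zero\<close>). Around \<open>p\<close> the squared distance decreases in each step by
  \<open>\<gamma> k (2 \<beta> k + \<gamma> k) (norm (x k - y k))\<^sup>2\<close> up to summable terms (\<open>relaxed_step_decrease\<close>). The
  weights \<open>\<gamma> k (2 \<beta> k + \<gamma> k)\<close> have a divergent sum, so the residuals come arbitrarily close to
  zero (\<open>residual_small_if_weights_diverge\<close>). Along a suitable choice of indices \<open>w\<close> tends to zero while
  \<open>y\<close> stays bounded, and a weak limit of \<open>y\<close> is a zero of \<open>A\<close> by maximality
  (\<open>zer_if_approximate_zeros\<close>).

  Two tools from Hilbert space theory carry this. Weak compactness is used in the form of a point
  in the closed convex hulls of all tails (\<open>bounded_seq_weak_limit\<close>). Minty's theorem, which both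
  provides the resolvent and regularises the search for the virtual zero, comes from a
  dual minimisation over averages of graph points that is strongly convex in the point sought (\<open>minty_point\<close>).
\<close>

section \<open>Weak limits of bounded sequences\<close>

text \<open>
  Two limits below are limits of almost minimisers of a uniformly convex functional. There the
  parallelogram law bounds the squared distance of two terms by twice the sum of their excesses
  over the infimum, which is the estimate assumed here.
\<close>

lemma convergent_if_dist_sq_le:
  fixes d :: "nat \<Rightarrow> 'a::{real_inner, banach}"
  assumes u: "u \<longlonglongrightarrow> 0"
    and d: "\<And>i j. i \<le> j \<Longrightarrow> (norm (d i - d j))\<^sup>2 \<le> u i + u j"
  shows "convergent d"
proof -
  have "\<exists>M. \<forall>m\<ge>M. \<forall>n\<ge>M. norm (d m - d n) < r" if "r > 0" for r
  proof -
    have "\<forall>\<^sub>F i in sequentially. u i < r\<^sup>2 / 2"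
      using u that by (intro order_tendstoD) auto
    then obtain M where M: "\<And>i. i \<ge> M \<Longrightarrow> u i < r\<^sup>2 / 2"
      by (auto simp: eventually_sequentially)
    have *: "norm (d m - d n) < r" if "m \<ge> M" "m \<le> n" for m n
    proof -
      have "(norm (d m - d n))\<^sup>2 < r\<^sup>2"
        using d[OF \<open>m \<le> n\<close>] M[of m] M[of n] that by simp
      then show ?thesis using \<open>r > 0\<close> by (simp add: power_less_imp_less_base)
    qed
    have "norm (d m - d n) < r" if "m \<ge> M" "n \<ge> M" for m n
      using *[of m n] *[of n m] that by (cases "m \<le> n") (auto simp: norm_minus_commute)
    then show ?thesis by blast
  qed
  then have "Cauchy d" by (rule CauchyI)
  then show ?thesis by (rule Cauchy_convergent)
qed

lemma norm_diff_sq_midpoint: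
  fixes a b :: "'a::real_inner"
  shows "(norm (a - b))\<^sup>2 =
    2 * (norm a)\<^sup>2 + 2 * (norm b)\<^sup>2 - 4 * (norm ((1/2) *\<^sub>R a + (1/2) *\<^sub>R b))\<^sup>2"
proof -
  have "(norm ((1/2) *\<^sub>R a + (1/2) *\<^sub>R b))\<^sup>2 = (norm (a + b))\<^sup>2 / 4"
    by (simp add: power_divide flip: scaleR_add_right)
  then show ?thesis
    unfolding power2_norm_eq_inner by (simp add: inner_simps inner_commute[of b a])
qed

text \<open>
  A substitute for weak sequential compactness: every eventual upper bound of a continuous linear
  functional along the sequence survives at \<open>p\<close>. The point \<open>p\<close> lies in the closed convex hull
  of every tail. It is found as the limit of almost shortest vectors \<open>h n\<close> in the hulls \<open>H n\<close>
  of the tails: these hulls decrease, so the squared minimal norms \<open>s n\<close> increase to a limit, and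
  since the midpoint of \<open>h i\<close> and \<open>h j\<close> stays in \<open>H i\<close> for \<open>i \<le> j\<close>, the parallelogram law
  makes \<open>h\<close> a Cauchy sequence.
\<close>

lemma bounded_seq_weak_limit:
  fixes z :: "nat \<Rightarrow> 'a::{real_inner, banach}"
  assumes "bounded (range z)"
  obtains p where
    "\<And>a b. (\<And>\<epsilon>. \<epsilon> > 0 \<Longrightarrow> \<forall>\<^sub>F n in sequentially. a \<bullet> z n \<le> b + \<epsilon>) \<Longrightarrow> a \<bullet> p \<le> b"
proof -
  define H where "H n = convex hull (z ` {n..})" for n
  define s where "s n = (INF h\<in>H n. (norm h)\<^sup>2)" for n
  obtain K where K: "\<And>n. norm (z n) \<le> K"
    using assms by (auto simp: bounded_iff)
  have zH: "z n \<in> H n" for n unfolding H_def by (rule hull_inc) auto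
  then have H_ne: "H n \<noteq> {}" for n by blast
  have bdd: "bdd_below ((\<lambda>h. (norm h)\<^sup>2) ` H n)" for n
    by (rule bdd_belowI[of _ 0]) auto
  have H_anti: "H k \<subseteq> H n" if "n \<le> k" for n k
    unfolding H_def using that by (intro hull_mono image_mono) auto
  have s_le: "s n \<le> (norm h)\<^sup>2" if "h \<in> H n" for h n
    unfolding s_def using bdd that by (rule cINF_lower)
  have s_mono: "incseq s"
    unfolding s_def using H_ne H_anti bdd
    by (intro monoI cINF_superset_mono) auto
  have s_bdd: "s n \<le> K\<^sup>2" for n
    using s_le[OF zH[of n]] power_mono[OF K[of n], of 2] by simp
  obtain s' where s': "s \<longlonglongrightarrow> s'" "\<And>n. s n \<le> s'"
    using incseq_convergent[OF s_mono, of "K\<^sup>2"] s_bdd by blast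
  have "\<exists>h\<in>H n. (norm h)\<^sup>2 < s n + 1 / Suc n" for n
    using cINF_less_iff[OF _ bdd, of n "s n + 1 / Suc n"] zH[of n]
    unfolding s_def by auto
  then obtain h where h: "\<And>n. h n \<in> H n" "\<And>n. (norm (h n))\<^sup>2 < s n + 1 / Suc n"
    by metis
  define u where "u n = 2 * (s' - s n) + 2 * (1 / Suc n)" for n
  have "u \<longlonglongrightarrow> 2 * (s' - s') + 2 * 0"
    unfolding u_def by (intro tendsto_intros s' LIMSEQ_Suc lim_1_over_n)
  moreover have "(norm (h i - h j))\<^sup>2 \<le> u i + u j" if "i \<le> j" for i j
  proof -
    have "(1/2) *\<^sub>R h i + (1/2) *\<^sub>R h j \<in> H i"
      using h(1)[of i] h(1)[of j] H_anti[OF that] unfolding H_def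
      by (intro convexD[OF convex_convex_hull]) auto
    then show ?thesis
      using s_le[of _ i] h(2)[of i] h(2)[of j] s'(2)[of i] s'(2)[of j]
      unfolding norm_diff_sq_midpoint[of "h i"] u_def by fastforce
  qed
  ultimately have "convergent h"
    by (intro convergent_if_dist_sq_le[of u]) auto
  then obtain p where p: "h \<longlonglongrightarrow> p" by (auto simp: convergent_def)
  have "a \<bullet> p \<le> b"
    if ev: "\<And>\<epsilon>. \<epsilon> > 0 \<Longrightarrow> \<forall>\<^sub>F n in sequentially. a \<bullet> z n \<le> b + \<epsilon>" for a b
  proof (rule field_le_epsilon)
    fix \<epsilon> :: real assume "\<epsilon> > 0"
    then obtain N where N: "\<And>n. n \<ge> N \<Longrightarrow> a \<bullet> z n \<le> b + \<epsilon>"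
      using ev by (auto simp: eventually_sequentially)
    have "H N \<subseteq> {w. a \<bullet> w \<le> b + \<epsilon>}"
      unfolding H_def using N by (intro hull_minimal convex_halfspace_le) auto
    then have "a \<bullet> h n \<le> b + \<epsilon>" if "n \<ge> N" for n
      using h(1)[of n] H_anti[OF that] by blast
    then show "a \<bullet> p \<le> b + \<epsilon>"
      by (intro LIMSEQ_le_const2[OF tendsto_inner[OF tendsto_const p]]) auto
  qed
  then show thesis by (rule that)
qed

section \<open>Minty's theorem and virtual zeros\<close>

text \<open>
  Averaging keeps the inequality between the product of the averages and the average of the
  products, because monotonicity of \<open>S\<close> says
  \<open>y \<bullet> v' + y' \<bullet> v \<le> y \<bullet> v + y' \<bullet> v'\<close>. For a fixed partner this inequality is affine in the
  other point, so it passes to the convex hull first in one argument and then in the other; on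
  the diagonal it is the claim.
\<close>

lemma monotone_set_hull_le:
  fixes S :: "('a::real_inner \<times> 'a) set"
  assumes mono: "\<And>y v y' v'. (y, v) \<in> S \<Longrightarrow> (y', v') \<in> S \<Longrightarrow> (y - y') \<bullet> (v - v') \<ge> 0"
    and q: "(a, b, q) \<in> convex hull ((\<lambda>(y, v). (y, v, y \<bullet> v)) ` S)"
  shows "a \<bullet> b \<le> q"
proof -
  let ?G = "convex hull ((\<lambda>(y, v). (y, v, y \<bullet> v)) ` S)"
  have conv: "convex {(a', b', q'). a' \<bullet> b + a \<bullet> b' \<le> q' + q}" for a b :: 'a and q
    unfolding convex_alt
  proof clarsimp
    fix a1 b1 a2 b2 :: 'a and q1 q2 t :: real
    assume *: "a1 \<bullet> b + a \<bullet> b1 \<le> q1 + q" "a2 \<bullet> b + a \<bullet> b2 \<le> q2 + q" "0 \<le> t" "t \<le> 1"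
    show "((1 - t) *\<^sub>R a1 + t *\<^sub>R a2) \<bullet> b + a \<bullet> ((1 - t) *\<^sub>R b1 + t *\<^sub>R b2)
       \<le> (1 - t) * q1 + t * q2 + q"
      using mult_left_mono[OF *(1), of "1 - t"] mult_left_mono[OF *(2), of t] *(3,4)
      by (simp add: inner_simps algebra_simps)
  qed
  have 1: "?G \<subseteq> {(a', b', q'). a' \<bullet> v + y \<bullet> b' \<le> q' + y \<bullet> v}" if "(y, v) \<in> S" for y v
    using mono[OF that] by (intro hull_minimal conv) (auto simp: inner_simps algebra_simps)
  have "?G \<subseteq> {(a', b', q'). a' \<bullet> b + a \<bullet> b' \<le> q' + q}"
  proof (intro hull_minimal conv image_subsetI)
    fix s assume "s \<in> S"
    then obtain y v where s: "s = (y, v)" "(y, v) \<in> S" by (cases s) auto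
    then have "a \<bullet> v + y \<bullet> b \<le> q + y \<bullet> v" using 1 q by blast
    then show "(case s of (y, v) \<Rightarrow> (y, v, y \<bullet> v)) \<in> {(a', b', q'). a' \<bullet> b + a \<bullet> b' \<le> q' + q}"
      unfolding s by simp
  qed
  with q show ?thesis by auto
qed

text \<open>
  The core of Minty's theorem, proved by duality. The wanted \<open>x\<close> makes all the functions
  \<open>(x - y) \<bullet> (x + v)\<close> nonpositive. A convex combination of these functions, described by averages
  \<open>(a, b, q)\<close> of the triples \<open>(y, v, y \<bullet> v)\<close>, is \<open>x \<bullet> x - x \<bullet> (a - b) - q\<close>; it is minimal at
  \<open>x = (a - b) / 2\<close>, with the value \<open>- f (a, b, q)\<close> where \<open>f\<close> is \<open>norm ((a - b) / 2)\<^sup>2 + q\<close>. By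
  \<open>monotone_set_hull_le\<close>, \<open>f\<close> is at least \<open>norm ((a + b) / 2)\<^sup>2 \<ge> 0\<close>. Along a minimising sequence
  of \<open>f\<close> the midpoints \<open>(a - b) / 2\<close> converge, and the first order optimality condition in the
  direction of a single triple says that their limit solves the primal problem.
\<close>

lemma minty_point:
  fixes S :: "('a::{real_inner, banach} \<times> 'a) set"
  assumes mono: "\<And>y v y' v'. (y, v) \<in> S \<Longrightarrow> (y', v') \<in> S \<Longrightarrow> (y - y') \<bullet> (v - v') \<ge> 0"
  obtains x where "\<And>y v. (y, v) \<in> S \<Longrightarrow> (x - y) \<bullet> (x + v) \<le> 0"
proof (cases "S = {}")
  case True
  then show thesis using that by blast
next
  case False
  define G where "G = convex hull ((\<lambda>(y, v). (y, v, y \<bullet> v)) ` S)"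
  define D :: "'a \<times> 'a \<times> real \<Rightarrow> 'a" where "D = (\<lambda>(a, b, q). (1/2) *\<^sub>R (a - b))"
  define Q :: "'a \<times> 'a \<times> real \<Rightarrow> real" where "Q = (\<lambda>(a, b, q). q)"
  define f where "f w = (norm (D w))\<^sup>2 + Q w" for w
  have f_nonneg: "f w \<ge> 0" if "w \<in> G" for w
  proof -
    obtain a b q where w: "w = (a, b, q)" by (metis prod_cases3)
    have "a \<bullet> b \<le> q"
      using monotone_set_hull_le[OF mono] that unfolding w G_def by blast
    moreover have "(norm ((1/2) *\<^sub>R (a - b)))\<^sup>2 + a \<bullet> b = (norm ((1/2) *\<^sub>R (a + b)))\<^sup>2"
      by (simp add: power2_norm_eq_inner inner_simps inner_commute algebra_simps)
    ultimately show ?thesis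
      unfolding f_def D_def Q_def w by (smt (verit) case_prod_conv zero_le_power2)
  qed
  define m where "m = (INF w\<in>G. f w)"
  have bdd: "bdd_below (f ` G)" using f_nonneg by (intro bdd_belowI[of _ 0]) auto
  have m_le: "m \<le> f w" if "w \<in> G" for w
    unfolding m_def using bdd that by (rule cINF_lower)
  have SG: "(y, v, y \<bullet> v) \<in> G" if "(y, v) \<in> S" for y v
    unfolding G_def using that by (intro hull_inc) force
  then have G_ne: "G \<noteq> {}" using False by auto
  have m_nonneg: "m \<ge> 0"
    unfolding m_def using G_ne f_nonneg by (rule cINF_greatest)
  have D_lin: "D (s *\<^sub>R w + t *\<^sub>R w') = s *\<^sub>R D w + t *\<^sub>R D w'"
    and Q_lin: "Q (s *\<^sub>R w + t *\<^sub>R w') = s * Q w + t * Q w'" for s t w w'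
    unfolding D_def Q_def by (auto simp: case_prod_beta algebra_simps)
  have "\<exists>w\<in>G. f w < m + 1 / Suc n" for n
    using cINF_less_iff[OF G_ne bdd, of "m + 1 / Suc n"] unfolding m_def by auto
  then obtain w where w: "\<And>n. w n \<in> G" "\<And>n. f (w n) < m + 1 / Suc n"
    by metis
  have lim_f: "(\<lambda>n. f (w n)) \<longlonglongrightarrow> m"
  proof (rule tendsto_sandwich[where f = "\<lambda>n. m" and h = "\<lambda>n. m + 1 / real (Suc n)"])
    show "(\<lambda>n. m + 1 / real (Suc n)) \<longlonglongrightarrow> m"
      using tendsto_add[OF tendsto_const[of m] LIMSEQ_Suc[OF lim_1_over_n]] by simp
    show "\<forall>\<^sub>F n in sequentially. m \<le> f (w n)"
      using m_le w(1) by simp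
    show "\<forall>\<^sub>F n in sequentially. f (w n) \<le> m + 1 / Suc n"
      using w(2) by (intro always_eventually allI less_imp_le)
  qed simp
  have "convergent (\<lambda>n. D (w n))"
  proof (rule convergent_if_dist_sq_le)
    show "(\<lambda>n. 2 * (1 / real (Suc n))) \<longlonglongrightarrow> 0"
      using tendsto_mult[OF tendsto_const[of 2] LIMSEQ_Suc[OF lim_1_over_n]] by simp
    fix i j
    have "(1/2) *\<^sub>R w i + (1/2) *\<^sub>R w j \<in> G"
      using w(1) unfolding G_def by (intro convexD[OF convex_convex_hull]) auto
    from m_le[OF this] show "(norm (D (w i) - D (w j)))\<^sup>2 \<le> 2 * (1 / real (Suc i)) + 2 * (1 / real (Suc j))"
      using w(2)[of i] w(2)[of j]
      unfolding f_def D_lin Q_lin norm_diff_sq_midpoint[of "D (w i)"] by argo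
  qed
  then obtain x where x: "(\<lambda>n. D (w n)) \<longlonglongrightarrow> x" by (auto simp: convergent_def)
  have "(x - y) \<bullet> (x + v) \<le> 0" if "(y, v) \<in> S" for y v
  proof -
    define d where "d = D (y, v, y \<bullet> v)"
    define L where "L = 2 * (x \<bullet> (d - x)) + (norm x)\<^sup>2 + y \<bullet> v - m"
    have "0 \<le> L + t * (norm (d - x))\<^sup>2" if t: "0 < t" "t \<le> 1" for t
    proof -
      \<comment> \<open>The segment from \<open>w n\<close> towards the triple stays in \<open>G\<close>, where \<open>f\<close> is at least \<open>m\<close>.\<close>
      have le: "m \<le> (norm ((1 - t) *\<^sub>R D (w n) + t *\<^sub>R d))\<^sup>2
          + ((1 - t) * (f (w n) - (norm (D (w n)))\<^sup>2) + t * (y \<bullet> v))" for n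
      proof -
        have "(1 - t) *\<^sub>R w n + t *\<^sub>R (y, v, y \<bullet> v) \<in> G"
          using w(1) SG[OF \<open>(y, v) \<in> S\<close>] t unfolding G_def
          by (intro convexD[OF convex_convex_hull]) auto
        from m_le[OF this] show ?thesis
          unfolding f_def D_lin Q_lin d_def by (simp add: Q_def)
      qed
      have "m \<le> (norm ((1 - t) *\<^sub>R x + t *\<^sub>R d))\<^sup>2
          + ((1 - t) * (m - (norm x)\<^sup>2) + t * (y \<bullet> v))"
      proof (rule LIMSEQ_le_const)
        show "(\<lambda>n. (norm ((1 - t) *\<^sub>R D (w n) + t *\<^sub>R d))\<^sup>2
            + ((1 - t) * (f (w n) - (norm (D (w n)))\<^sup>2) + t * (y \<bullet> v)))
          \<longlonglongrightarrow> (norm ((1 - t) *\<^sub>R x + t *\<^sub>R d))\<^sup>2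
            + ((1 - t) * (m - (norm x)\<^sup>2) + t * (y \<bullet> v))"
          by (intro tendsto_intros x lim_f)
      qed (use le in blast)
      also have "\<dots> = m + t * (L + t * (norm (d - x))\<^sup>2)"
        unfolding L_def
        by (simp add: power2_norm_eq_inner inner_simps inner_commute algebra_simps)
      finally show ?thesis using t by (simp add: zero_le_mult_iff)
    qed
    \<comment> \<open>Letting the step \<open>t\<close> tend to zero leaves the directional derivative \<open>L\<close>.\<close>
    then have ev: "\<forall>\<^sub>F t in at_right 0. 0 \<le> L + t * (norm (d - x))\<^sup>2"
      by (intro eventually_at_rightI[of 0 1]) auto
    have lim: "((\<lambda>t. L + t * (norm (d - x))\<^sup>2) \<longlongrightarrow> L + 0 * (norm (d - x))\<^sup>2) (at_right 0)"
      by (intro tendsto_intros)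
    have "0 \<le> L"
      using tendsto_lowerbound[OF lim ev] by simp
    moreover have "(x - y) \<bullet> (x + v) = - (L + m)"
      unfolding L_def d_def D_def
      by (simp add: power2_norm_eq_inner inner_simps inner_commute algebra_simps)
    ultimately show ?thesis using m_nonneg by simp
  qed
  then show thesis by (rule that)
qed

lemma minty_point_scaled:
  fixes S :: "('a::{real_inner, banach} \<times> 'a) set"
  assumes mono: "\<And>y v y' v'. (y, v) \<in> S \<Longrightarrow> (y', v') \<in> S \<Longrightarrow> (y - y') \<bullet> (v - v') \<ge> 0"
    and \<epsilon>: "\<epsilon> > 0"
  obtains x where "\<And>y v. (y, v) \<in> S \<Longrightarrow> (x - y) \<bullet> (\<epsilon> *\<^sub>R x + v - w) \<le> 0"
proof -
  let ?S = "(\<lambda>(y, v). (y, (1 / \<epsilon>) *\<^sub>R (v - w))) ` S"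
  have mono': "(y - y') \<bullet> (v - v') \<ge> 0" if "(y, v) \<in> ?S" "(y', v') \<in> ?S" for y v y' v'
  proof -
    from that obtain v0 v0' where "(y, v0) \<in> S" "(y', v0') \<in> S"
      and v: "v = (1 / \<epsilon>) *\<^sub>R (v0 - w)" "v' = (1 / \<epsilon>) *\<^sub>R (v0' - w)" by auto
    moreover have "v - v' = (1 / \<epsilon>) *\<^sub>R (v0 - v0')"
      unfolding v by (simp flip: scaleR_diff_right)
    ultimately show "(y - y') \<bullet> (v - v') \<ge> 0"
      using mono \<epsilon> by simp
  qed
  obtain x where x: "\<And>y v. (y, v) \<in> ?S \<Longrightarrow> (x - y) \<bullet> (x + v) \<le> 0"
    using minty_point[of ?S, OF mono'] by blast
  show thesis
  proof
    fix y v assume "(y, v) \<in> S"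
    then have "(x - y) \<bullet> (x + (1 / \<epsilon>) *\<^sub>R (v - w)) \<le> 0" by (intro x) force
    moreover have "\<epsilon> *\<^sub>R x + v - w = \<epsilon> *\<^sub>R (x + (1 / \<epsilon>) *\<^sub>R (v - w))"
      using \<epsilon> by (simp add: algebra_simps)
    ultimately show "(x - y) \<bullet> (\<epsilon> *\<^sub>R x + v - w) \<le> 0"
      using \<epsilon> by (simp add: mult_le_0_iff)
  qed
qed

text \<open>
  A monotone set whose first components are bounded has a virtual zero: a point \<open>p\<close> such that
  adjoining \<open>(p, 0)\<close> keeps the set monotone. Take the solutions \<open>x n\<close> of the problem regularised
  with weight \<open>1 / (n + 1)\<close>. If one of them has norm at least the bound \<open>\<rho>\<close> of the first components, its
  regularising term already has the favourable sign and \<open>p = x n\<close> works exactly. Otherwise all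
  \<open>x n\<close> stay in the ball of radius \<open>\<rho>\<close>, the regularising terms vanish in the limit, and a weak
  limit of \<open>x\<close> works.
\<close>

lemma bounded_monotone_set_zero:
  fixes S :: "('a::{real_inner, banach} \<times> 'a) set"
  assumes mono: "\<And>y v y' v'. (y, v) \<in> S \<Longrightarrow> (y', v') \<in> S \<Longrightarrow> (y - y') \<bullet> (v - v') \<ge> 0"
    and bdd: "bounded (fst ` S)"
  obtains p where "\<And>y v. (y, v) \<in> S \<Longrightarrow> (y - p) \<bullet> v \<ge> 0"
proof -
  have "\<exists>\<rho>. \<forall>y v. (y, v) \<in> S \<longrightarrow> norm y \<le> \<rho>"
    using bdd unfolding bounded_iff by fastforce
  then obtain \<rho> where \<rho>: "\<And>y v. (y, v) \<in> S \<Longrightarrow> norm y \<le> \<rho>"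
    by blast
  have "\<exists>x. \<forall>y v. (y, v) \<in> S \<longrightarrow> (x - y) \<bullet> ((1 / real (Suc n)) *\<^sub>R x + v) \<le> 0" for n
  proof -
    obtain x where "\<And>y v. (y, v) \<in> S \<Longrightarrow> (x - y) \<bullet> ((1 / real (Suc n)) *\<^sub>R x + v - 0) \<le> 0"
      using minty_point_scaled[of S "1 / real (Suc n)" 0, OF mono] by auto
    then show ?thesis by auto
  qed
  then have "\<exists>x. \<forall>n y v. (y, v) \<in> S \<longrightarrow> (x n - y) \<bullet> ((1 / real (Suc n)) *\<^sub>R x n + v) \<le> 0"
    by (intro choice allI)
  then obtain x where
    x: "\<And>n y v. (y, v) \<in> S \<Longrightarrow> (x n - y) \<bullet> ((1 / real (Suc n)) *\<^sub>R x n + v) \<le> 0"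
    by blast
  \<comment> \<open>The right-hand side is nonpositive as soon as \<open>norm (x n) \<ge> \<rho>\<close>.\<close>
  have xv: "(x n - y) \<bullet> v \<le> (1 / real (Suc n)) * (norm (x n) * (\<rho> - norm (x n)))"
    if "(y, v) \<in> S" for n y v
  proof -
    have "y \<bullet> x n \<le> \<rho> * norm (x n)"
      using norm_cauchy_schwarz[of y "x n"] mult_right_mono[OF \<rho>[OF that], of "norm (x n)"] by simp
    then have "(y - x n) \<bullet> x n \<le> norm (x n) * (\<rho> - norm (x n))"
      by (simp add: algebra_simps inner_simps flip: power2_norm_eq_inner power2_eq_square)
    then have "(1 / real (Suc n)) * ((y - x n) \<bullet> x n) \<le> (1 / real (Suc n)) * (norm (x n) * (\<rho> - norm (x n)))"
      by (intro mult_left_mono) auto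
    moreover have "(x n - y) \<bullet> v \<le> (1 / real (Suc n)) * ((y - x n) \<bullet> x n)"
      using x[OF that, of n] by (simp add: inner_simps field_simps)
    ultimately show ?thesis by simp
  qed
  show thesis
  proof (cases "\<exists>n. norm (x n) \<ge> \<rho>")
    case True
    then obtain n where "norm (x n) \<ge> \<rho>" by blast
    then have "(1 / real (Suc n)) * (norm (x n) * (\<rho> - norm (x n))) \<le> 0"
      by (intro mult_nonneg_nonpos) auto
    then have "(x n - y) \<bullet> v \<le> 0" if "(y, v) \<in> S" for y v
      using xv[OF that, of n] by linarith
    then show thesis using that[of "x n"] by (simp add: inner_simps)
  next
    case False
    then have nx: "norm (x n) \<le> \<rho>" for n by (meson linear)
    then have "bounded (range x)" by (auto simp: bounded_iff)
    then obtain p where p: "\<And>a b.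
        (\<And>\<epsilon>. \<epsilon> > 0 \<Longrightarrow> \<forall>\<^sub>F n in sequentially. a \<bullet> x n \<le> b + \<epsilon>) \<Longrightarrow> a \<bullet> p \<le> b"
      using bounded_seq_weak_limit by blast
    have "\<rho> \<ge> 0" using nx[of 0] norm_ge_zero order_trans by blast
    have small: "(x n - y) \<bullet> v \<le> (1 / real (Suc n)) * \<rho>\<^sup>2" if "(y, v) \<in> S" for n y v
    proof -
      have "norm (x n) * (\<rho> - norm (x n)) \<le> \<rho> * \<rho>"
        using nx[of n] \<open>\<rho> \<ge> 0\<close> by (intro mult_mono) auto
      then have "(1 / real (Suc n)) * (norm (x n) * (\<rho> - norm (x n))) \<le> (1 / real (Suc n)) * \<rho>\<^sup>2"
        unfolding power2_eq_square by (intro mult_left_mono) auto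
      then show ?thesis using xv[OF that, of n] by simp
    qed
    have "v \<bullet> p \<le> v \<bullet> y" if "(y, v) \<in> S" for y v
    proof (rule p)
      fix \<epsilon> :: real assume "\<epsilon> > 0"
      have "(\<lambda>n. (1 / real (Suc n)) * \<rho>\<^sup>2) \<longlonglongrightarrow> 0"
        using tendsto_mult[OF LIMSEQ_Suc[OF lim_1_over_n] tendsto_const[of "\<rho>\<^sup>2"]] by simp
      then have "\<forall>\<^sub>F n in sequentially. (1 / real (Suc n)) * \<rho>\<^sup>2 < \<epsilon>"
        using \<open>\<epsilon> > 0\<close> by (rule order_tendstoD)
      then show "\<forall>\<^sub>F n in sequentially. v \<bullet> x n \<le> v \<bullet> y + \<epsilon>"
      proof eventually_elim
        case (elim n)
        then show ?case using small[OF that, of n] by (simp add: inner_simps inner_commute)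
      qed
    qed
    then show thesis using that[of p] by (simp add: inner_simps inner_commute)
  qed
qed

section \<open>Resolvents and zeros of maximally monotone operators\<close>

lemma maximally_monotone_memI:
  assumes A: "maximally_monotone A"
    and rel: "\<And>y v. v \<in> A y \<Longrightarrow> (x - y) \<bullet> (w - v) \<ge> 0"
  shows "w \<in> A x"
proof (rule ccontr)
  assume w: "w \<notin> A x"
  define B where "B = A(x := insert w (A x))"
  have gra_B: "gra B = insert (x, w) (gra A)"
    unfolding gra_def B_def by (auto split: if_splits)
  have rel': "(y - x) \<bullet> (v - w) \<ge> 0" if "v \<in> A y" for y v
    using rel[OF that] by (simp add: inner_simps)
  have "monotone_op B"
    using A rel rel' unfolding maximally_monotone_def monotone_op_def gra_B
    by (auto simp: gra_def)
  moreover have "gra A \<subset> gra B"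
    unfolding gra_B using w by (auto simp: gra_def)
  ultimately show False using A unfolding maximally_monotone_def by blast
qed

lemma maximally_monotoneD:
  assumes "maximally_monotone A" "w \<in> A x" "v \<in> A y"
  shows "(x - y) \<bullet> (w - v) \<ge> 0"
proof -
  have "\<forall>(x, w)\<in>gra A. \<forall>(y, v)\<in>gra A. (x - y) \<bullet> (w - v) \<ge> 0"
    using assms(1) unfolding maximally_monotone_def monotone_op_def by (rule conjunct1)
  moreover have "(x, w) \<in> gra A" "(y, v) \<in> gra A"
    using assms(2,3) by (auto simp: gra_def)
  ultimately show ?thesis by fastforce
qed

text \<open>
  By \<open>minty_point_scaled\<close> the set defining the resolvent contains a point, and monotonicity of
  \<open>A\<close> makes it unique, so the choice in the definition of \<^const>\<open>resolvent\<close> is determined.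
\<close>

lemma resolvent_mem:
  fixes A :: "'a::{real_inner, banach} \<Rightarrow> 'a set"
  assumes A: "maximally_monotone A" and c: "c > 0"
  shows "(1 / c) *\<^sub>R (x - resolvent c A x) \<in> A (resolvent c A x)"
proof -
  have iff: "y \<in> resolvent_op c A x \<longleftrightarrow> (1 / c) *\<^sub>R (x - y) \<in> A y" for y
    using c unfolding resolvent_op_def inverse_op_def by force
  obtain y where y: "\<And>z v. (z, v) \<in> gra A \<Longrightarrow>
      (y - z) \<bullet> ((1 / c) *\<^sub>R y + v - (1 / c) *\<^sub>R x) \<le> 0"
    using minty_point_scaled[of "gra A" "1 / c"] maximally_monotoneD[OF A] c
    by (auto simp: gra_def)
  have y_mem: "y \<in> resolvent_op c A x"
    unfolding iff
  proof (rule maximally_monotone_memI[OF A])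
    fix z v assume "v \<in> A z"
    then have "(y - z) \<bullet> ((1 / c) *\<^sub>R y + v - (1 / c) *\<^sub>R x) \<le> 0"
      by (intro y) (simp add: gra_def)
    then show "(y - z) \<bullet> ((1 / c) *\<^sub>R (x - y) - v) \<ge> 0"
      by (simp add: inner_simps algebra_simps)
  qed
  moreover have "z = y" if "z \<in> resolvent_op c A x" for z
  proof -
    have "(z - y) \<bullet> ((1 / c) *\<^sub>R (x - z) - (1 / c) *\<^sub>R (x - y)) \<ge> 0"
      using maximally_monotoneD[OF A] that y_mem unfolding iff by blast
    moreover have "(1 / c) *\<^sub>R (x - z) - (1 / c) *\<^sub>R (x - y) = - ((1 / c) *\<^sub>R (z - y))"
      by (simp add: algebra_simps)
    ultimately have "(1 / c) * ((z - y) \<bullet> (z - y)) \<le> 0" by simp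
    then show ?thesis using c by (simp add: divide_le_0_iff flip: power2_norm_eq_inner)
  qed
  ultimately have "resolvent_op c A x = {y}" by blast
  then show ?thesis using y_mem unfolding iff resolvent_def by simp
qed

text \<open>
  The graph of a maximally monotone operator is closed for weak convergence in the domain and
  strong convergence in the range: for \<open>v \<in> A z\<close>, monotonicity bounds \<open>(y n - z) \<bullet> v\<close> by
  \<open>(y n - z) \<bullet> w n\<close>, which tends to \<open>0\<close>. So \<open>0\<close> is monotonically related at a weak limit of
  \<open>y\<close> to every point of the graph.
\<close>

lemma zer_if_approximate_zeros:
  fixes A :: "'a::{real_inner, banach} \<Rightarrow> 'a set"
  assumes A: "maximally_monotone A"
    and w: "\<And>n. w n \<in> A (y n)" "w \<longlonglongrightarrow> 0"
    and y: "bounded (range y)"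
  shows "zer A \<noteq> {}"
proof -
  obtain p where p: "\<And>a b.
      (\<And>\<epsilon>. \<epsilon> > 0 \<Longrightarrow> \<forall>\<^sub>F n in sequentially. a \<bullet> y n \<le> b + \<epsilon>) \<Longrightarrow> a \<bullet> p \<le> b"
    using bounded_seq_weak_limit[OF y] by blast
  have "0 \<in> A p"
  proof (rule maximally_monotone_memI[OF A])
    fix z v assume v: "v \<in> A z"
    have lim: "(\<lambda>n. (y n - z) \<bullet> w n) \<longlonglongrightarrow> 0"
    proof -
      obtain K where K: "\<And>n. norm (y n) \<le> K" using y by (auto simp: bounded_iff)
      have "norm ((y n - z) \<bullet> w n) \<le> norm (w n) * (K + norm z)" for n
      proof -
        have "norm (y n - z) \<le> K + norm z"
          using norm_triangle_ineq4[of "y n" z] K[of n] by linarith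
        then have "norm (y n - z) * norm (w n) \<le> (K + norm z) * norm (w n)"
          by (intro mult_right_mono) auto
        then show ?thesis
          using Cauchy_Schwarz_ineq2[of "y n - z" "w n"] by (simp add: mult.commute)
      qed
      then show ?thesis
        using w(2) by (intro tendsto_0_le[OF w(2), of _ "K + norm z"]) auto
    qed
    have "v \<bullet> p \<le> v \<bullet> z"
    proof (rule p)
      fix \<epsilon> :: real assume "\<epsilon> > 0"
      with lim have "\<forall>\<^sub>F n in sequentially. (y n - z) \<bullet> w n < \<epsilon>"
        by (rule order_tendstoD)
      then show "\<forall>\<^sub>F n in sequentially. v \<bullet> y n \<le> v \<bullet> z + \<epsilon>"
      proof eventually_elim
        case (elim n)
        then show ?case
          using maximally_monotoneD[OF A w(1)[of n] v]
          by (simp add: inner_simps inner_commute)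
      qed
    qed
    then show "(p - z) \<bullet> (0 - v) \<ge> 0" by (simp add: inner_simps inner_commute)
  qed
  then show ?thesis by (auto simp: zer_def)
qed

section \<open>One relaxed proximal step\<close>

text \<open>
  With \<open>X\<close> and \<open>Y\<close> the positions of the iterate and of its resolvent relative to a (virtual)
  zero, the step is a combination of \<open>X\<close> and its reflection \<open>2 Y - X\<close> with coefficients
  \<open>b + g / 2\<close> and \<open>g / 2\<close>, and the hypothesis on \<open>Y\<close> says that the reflection is no longer
  than \<open>X\<close>.
\<close>

lemma relaxed_step_nonexpansive:
  fixes X Y :: "'a::real_inner"
  assumes firm: "Y \<bullet> (X - Y) \<ge> 0" and coeff: "\<bar>b + g / 2\<bar> + \<bar>g / 2\<bar> \<le> 1"
  shows "norm (b *\<^sub>R X + g *\<^sub>R Y) \<le> norm X"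
proof -
  have "(norm (2 *\<^sub>R Y - X))\<^sup>2 = (norm X)\<^sup>2 - 4 * (Y \<bullet> (X - Y))"
    unfolding power2_norm_eq_inner by (simp add: inner_simps inner_commute[of Y X])
  then have "(norm (2 *\<^sub>R Y - X))\<^sup>2 \<le> (norm X)\<^sup>2" using firm by linarith
  then have refl: "norm (2 *\<^sub>R Y - X) \<le> norm X"
    by (rule power2_le_imp_le) simp
  have "b *\<^sub>R X + g *\<^sub>R Y = (b + g / 2) *\<^sub>R X + (g / 2) *\<^sub>R (2 *\<^sub>R Y - X)"
    by (simp add: algebra_simps)
  then have "norm (b *\<^sub>R X + g *\<^sub>R Y)
      \<le> \<bar>b + g / 2\<bar> * norm X + \<bar>g / 2\<bar> * norm (2 *\<^sub>R Y - X)"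
    using norm_triangle_ineq[of "(b + g / 2) *\<^sub>R X" "(g / 2) *\<^sub>R (2 *\<^sub>R Y - X)"] by simp
  also have "\<dots> \<le> \<bar>b + g / 2\<bar> * norm X + \<bar>g / 2\<bar> * norm X"
    using refl by (intro add_left_mono mult_left_mono) auto
  also have "\<dots> = (\<bar>b + g / 2\<bar> + \<bar>g / 2\<bar>) * norm X" by (simp add: distrib_right)
  also have "\<dots> \<le> 1 * norm X" using coeff by (intro mult_right_mono) auto
  finally show ?thesis by simp
qed

text \<open>
  Expanding the square leaves, besides the two terms of the bound, only the term
  \<open>- 2 g (b + g) (Y \<bullet> (X - Y))\<close>, which is nonpositive.
\<close>

lemma relaxed_step_decrease:
  fixes X Y :: "'a::real_inner"
  assumes firm: "Y \<bullet> (X - Y) \<ge> 0" and sgn: "g * (b + g) \<ge> 0" and coeff: "\<bar>b + g\<bar> \<le> 1"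
  shows "(norm (b *\<^sub>R X + g *\<^sub>R Y))\<^sup>2 \<le> (norm X)\<^sup>2 - g * (2 * b + g) * (norm (X - Y))\<^sup>2"
proof -
  have "(norm (b *\<^sub>R X + g *\<^sub>R Y))\<^sup>2 = (b + g)\<^sup>2 * (norm X)\<^sup>2
      - g * (2 * b + g) * (norm (X - Y))\<^sup>2 - 2 * (g * (b + g)) * (Y \<bullet> (X - Y))"
    unfolding power2_norm_eq_inner
    by (simp add: inner_simps inner_commute[of Y X] power2_eq_square algebra_simps)
  moreover have "(b + g)\<^sup>2 * (norm X)\<^sup>2 \<le> 1 * (norm X)\<^sup>2"
    using coeff by (intro mult_right_mono) (auto simp: abs_square_le_1)
  moreover have "2 * (g * (b + g)) * (Y \<bullet> (X - Y)) \<ge> 0"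
    using firm sgn by simp
  ultimately show ?thesis by linarith
qed

lemma perturbed_step_dist:
  fixes x' x y u e p :: "'a::real_normed_vector"
  assumes "x' = a *\<^sub>R u + b *\<^sub>R x + g *\<^sub>R y + d *\<^sub>R e"
  shows "norm (x' - p) \<le> norm (b *\<^sub>R (x - p) + g *\<^sub>R (y - p))
    + (\<bar>a\<bar> * norm u + \<bar>1 - b - g\<bar> * norm p + norm (d *\<^sub>R e))"
proof -
  let ?v = "a *\<^sub>R u - (1 - b - g) *\<^sub>R p + d *\<^sub>R e"
  have "x' - p = (b *\<^sub>R (x - p) + g *\<^sub>R (y - p)) + ?v"
    unfolding assms by (simp add: algebra_simps)
  moreover have "norm ?v \<le> \<bar>a\<bar> * norm u + \<bar>1 - b - g\<bar> * norm p + norm (d *\<^sub>R e)"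
    using norm_triangle_ineq[of "a *\<^sub>R u - (1 - b - g) *\<^sub>R p" "d *\<^sub>R e"]
      norm_triangle_ineq4[of "a *\<^sub>R u" "(1 - b - g) *\<^sub>R p"] by simp
  ultimately show ?thesis
    using norm_triangle_ineq[of "b *\<^sub>R (x - p) + g *\<^sub>R (y - p)" ?v] by simp
qed

section \<open>Quasi-Fejer estimates\<close>

lemma bounded_if_quasi_Fejer:
  fixes x :: "nat \<Rightarrow> 'a::real_normed_vector"
  assumes step: "\<And>k. norm (x (Suc k) - p) \<le> norm (x k - p) + \<epsilon> k"
    and sum: "summable \<epsilon>" and nonneg: "\<And>k. \<epsilon> k \<ge> 0"
  shows "bounded (range x)"
proof -
  have "norm (x n - p) \<le> norm (x 0 - p) + (\<Sum>k<n. \<epsilon> k)" for n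
  proof (induction n)
    case (Suc n)
    then show ?case using step[of n] by simp
  qed simp
  then have "norm (x n - p) \<le> norm (x 0 - p) + suminf \<epsilon>" for n
    using sum_le_suminf[OF sum, of "{..<n}"] nonneg
    by (meson add_left_mono finite_lessThan order_trans)
  then have "norm (x n) \<le> norm p + (norm (x 0 - p) + suminf \<epsilon>)" for n
    using norm_triangle_sub[of "x n" p] by (meson add_left_mono order_trans)
  then show ?thesis by (auto simp: bounded_iff)
qed

text \<open>
  Here \<open>a\<close> is the distance of the iterates to a virtual zero, \<open>b\<close> the same distance after an
  unperturbed step, \<open>r\<close> the residual and \<open>\<epsilon>\<close> the perturbation. Up to summable terms
  \<open>\<theta> k * (r k)\<^sup>2\<close> is dominated by the decrease of \<open>(a k)\<^sup>2\<close>, so its sum telescopes to a finite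
  bound. If \<open>r\<close> stayed above \<open>\<eta>\<close>, the sum of the weights \<open>\<theta>\<close> would be bounded too.
\<close>

lemma residual_small_if_weights_diverge:
  fixes a b r \<epsilon> \<theta> :: "nat \<Rightarrow> real"
  assumes a: "\<And>k. 0 \<le> a k" "\<And>k. a k \<le> K"
    and b: "\<And>k. 0 \<le> b k"
    and \<epsilon>: "\<And>k. 0 \<le> \<epsilon> k" "summable \<epsilon>"
    and step: "\<And>k. k \<ge> N \<Longrightarrow> a (Suc k) \<le> b k + \<epsilon> k"
    and decrease: "\<And>k. k \<ge> N \<Longrightarrow> (b k)\<^sup>2 \<le> (a k)\<^sup>2 - \<theta> k * (r k)\<^sup>2"
    and \<theta>: "\<And>k. k \<ge> N \<Longrightarrow> 0 \<le> \<theta> k"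
    and diverge: "filterlim (\<lambda>n. \<Sum>k<n. \<theta> k) at_top sequentially"
    and \<eta>: "\<eta> > 0"
  obtains k where "k \<ge> N" "r k < \<eta>"
proof (rule ccontr)
  assume "\<not> thesis"
  then have r: "\<eta> \<le> r k" if "k \<ge> N" for k
    using \<open>k \<ge> N\<close> \<open>\<And>k. N \<le> k \<Longrightarrow> r k < \<eta> \<Longrightarrow> thesis\<close> linorder_not_le by blast
  define E where "E = suminf \<epsilon>"
  have \<epsilon>_le: "\<epsilon> k \<le> E" for k
    unfolding E_def using sum_le_suminf[OF \<epsilon>(2), of "{k}"] \<epsilon>(1) by simp
  \<comment> \<open>A bound for \<open>2 * b k + \<epsilon> k\<close>, the factor of \<open>\<epsilon> k\<close> in the increment of the square.\<close>
  define M where "M = 2 * K + E"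
  have "K \<ge> 0" using a[of 0] by linarith
  then have M: "M \<ge> 0" unfolding M_def using \<epsilon>_le[of 0] \<epsilon>(1)[of 0] by linarith
  have one: "\<eta>\<^sup>2 * \<theta> k \<le> (a k)\<^sup>2 - (a (Suc k))\<^sup>2 + M * \<epsilon> k" if k: "k \<ge> N" for k
  proof -
    have "\<eta>\<^sup>2 \<le> (r k)\<^sup>2" using r[OF k] \<eta> by (intro power_mono) auto
    then have 1: "\<eta>\<^sup>2 * \<theta> k \<le> \<theta> k * (r k)\<^sup>2"
      using mult_left_mono[of _ _ "\<theta> k"] \<theta>[OF k] by (metis mult.commute)
    have "0 \<le> \<theta> k * (r k)\<^sup>2" using \<theta>[OF k] by simp
    then have "(b k)\<^sup>2 \<le> (a k)\<^sup>2" using decrease[OF k] by linarith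
    then have "b k \<le> K" using a[of k] by (meson power2_le_imp_le order_trans)
    then have "2 * b k + \<epsilon> k \<le> M" unfolding M_def using \<epsilon>_le[of k] by linarith
    then have 2: "(2 * b k + \<epsilon> k) * \<epsilon> k \<le> M * \<epsilon> k" using \<epsilon>(1) by (intro mult_right_mono)
    have "(a (Suc k))\<^sup>2 \<le> (b k + \<epsilon> k)\<^sup>2" using step[OF k] a(1) by (intro power_mono)
    also have "\<dots> = (b k)\<^sup>2 + (2 * b k + \<epsilon> k) * \<epsilon> k"
      by (simp add: power2_eq_square algebra_simps)
    finally show ?thesis using 1 2 decrease[OF k] by linarith
  qed
  have sums: "\<eta>\<^sup>2 * (\<Sum>k<N + m. \<theta> k) \<le>
      \<eta>\<^sup>2 * (\<Sum>k<N. \<theta> k) + (a N)\<^sup>2 - (a (N + m))\<^sup>2 + M * (\<Sum>k<N + m. \<epsilon> k)" for m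
  proof (induction m)
    case 0
    have "M * (\<Sum>k<N. \<epsilon> k) \<ge> 0" using M \<epsilon>(1) by (simp add: sum_nonneg)
    then show ?case by simp
  next
    case (Suc m)
    then show ?case using one[of "N + m"] by (simp add: distrib_left)
  qed
  define C where "C = \<eta>\<^sup>2 * (\<Sum>k<N. \<theta> k) + (a N)\<^sup>2 + M * E"
  have bound: "\<eta>\<^sup>2 * (\<Sum>k<N + m. \<theta> k) \<le> C" for m
  proof -
    have "(\<Sum>k<N + m. \<epsilon> k) \<le> E"
      unfolding E_def using \<epsilon> by (intro sum_le_suminf) auto
    then have "M * (\<Sum>k<N + m. \<epsilon> k) \<le> M * E" using M by (intro mult_left_mono)
    moreover have "(a (N + m))\<^sup>2 \<ge> 0" by simp
    ultimately show ?thesis using sums[of m] unfolding C_def by linarith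
  qed
  have "\<forall>\<^sub>F n in sequentially. C / \<eta>\<^sup>2 < (\<Sum>k<n. \<theta> k)"
    using diverge unfolding filterlim_at_top_dense by blast
  then obtain n0 where n0: "\<And>n. n \<ge> n0 \<Longrightarrow> C / \<eta>\<^sup>2 < (\<Sum>k<n. \<theta> k)"
    by (auto simp: eventually_sequentially)
  have "C < \<eta>\<^sup>2 * (\<Sum>k<N + n0. \<theta> k)"
    using n0[of "N + n0"] \<eta> by (simp add: field_simps)
  then show False using bound[of n0] by simp
qed

section \<open>Consequences of the parameter conditions\<close>

lemma sum_at_top_if_eventually_ge:
  fixes \<theta> :: "nat \<Rightarrow> real"
  assumes "\<eta> > 0" "\<forall>\<^sub>F k in sequentially. \<eta> \<le> \<theta> k"
  shows "filterlim (\<lambda>n. \<Sum>k<n. \<theta> k) at_top sequentially"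
proof -
  obtain N where N: "\<And>k. k \<ge> N \<Longrightarrow> \<eta> \<le> \<theta> k"
    using assms(2) by (auto simp: eventually_sequentially)
  define C where "C = (\<Sum>k<N. \<theta> k) - \<eta> * real N"
  have "C + \<eta> * real n \<le> (\<Sum>k<n. \<theta> k)" if "n \<ge> N" for n
    using that
  proof (induction n rule: dec_induct)
    case base
    then show ?case by (simp add: C_def)
  next
    case (step n)
    then show ?case using N[of n] by (simp add: distrib_left)
  qed
  then have "\<forall>\<^sub>F n in sequentially. C + \<eta> * real n \<le> (\<Sum>k<n. \<theta> k)"
    by (auto simp: eventually_sequentially)
  moreover have "filterlim (\<lambda>n. C + \<eta> * real n) at_top sequentially"
    by (intro filterlim_tendsto_add_at_top[OF tendsto_const]
        filterlim_tendsto_pos_mult_at_top[OF tendsto_const \<open>\<eta> > 0\<close>] filterlim_real_sequentially)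
  ultimately show ?thesis by (rule filterlim_at_top_mono[rotated])
qed

lemma bounded_below_pos:
  fixes c :: "nat \<Rightarrow> real"
  assumes pos: "\<And>k. c k > 0"
    and c: "(INF k. c k) > 0 \<or> filterlim c at_top sequentially"
  obtains c0 where "c0 > 0" "\<And>k. c0 \<le> c k"
  using c
proof
  assume *: "(INF k. c k) > 0"
  have "bdd_below (range c)" using pos by (intro bdd_belowI[of _ 0]) (auto intro: less_imp_le)
  then show thesis using that * by (blast intro: cINF_lower)
next
  assume "filterlim c at_top sequentially"
  then have "\<forall>\<^sub>F k in sequentially. 1 \<le> c k" unfolding filterlim_at_top by blast
  then obtain N where N: "\<And>k. k \<ge> N \<Longrightarrow> 1 \<le> c k" by (auto simp: eventually_sequentially)
  let ?F = "insert 1 (c ` {..N})"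
  show thesis
  proof (rule that[of "Min ?F"])
    show "Min ?F > 0" using pos by (subst Min_gr_iff) auto
    show "Min ?F \<le> c k" for k
    proof (cases "k \<le> N")
      case True
      then show ?thesis by (intro Min_le) auto
    next
      case False
      then have "Min ?F \<le> 1" "1 \<le> c k" using N by auto
      then show ?thesis by linarith
    qed
  qed
qed

lemma liminf_ereal_pos:
  assumes "liminf (\<lambda>k. ereal (f k)) > 0"
  obtains \<eta> where "\<eta> > 0" "\<forall>\<^sub>F k in sequentially. \<eta> \<le> f k"
proof -
  obtain \<eta> where "0 < ereal \<eta>" "ereal \<eta> < liminf (\<lambda>k. ereal (f k))"
    using assms ereal_dense2 by blast
  then have "\<eta> > 0" "\<forall>\<^sub>F k in sequentially. ereal \<eta> < ereal (f k)"
    by (auto dest: less_LiminfD)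
  moreover from this(2) have "\<forall>\<^sub>F k in sequentially. \<eta> \<le> f k"
    by eventually_elim simp
  ultimately show thesis using that by blast
qed

lemma eventually_ge_half:
  fixes f :: "nat \<Rightarrow> real"
  assumes "f \<longlonglongrightarrow> 1"
  shows "\<forall>\<^sub>F k in sequentially. 1 / 2 \<le> f k"
proof -
  have "\<forall>\<^sub>F k in sequentially. 1 / 2 < f k"
    using assms by (rule order_tendstoD) simp
  then show ?thesis by eventually_elim simp
qed

lemma norm_triangle4_minus:
  fixes a b c d :: "'a::real_normed_vector"
  shows "norm (a - b - c - d) \<le> norm a + norm b + norm c + norm d"
  using norm_triangle_ineq4[of "a - b - c" d] norm_triangle_ineq4[of "a - b" c]
    norm_triangle_ineq4[of a b] by linarith

section \<open>Bounded orbits and zeros\<close>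

text \<open>
  No zero of \<open>A\<close> is available here, but a virtual one is: from some index \<open>N\<close> on, the
  resolvent values \<open>y k\<close> are bounded, because the recursion expresses \<open>\<gamma> k *\<^sub>R y k\<close> by
  bounded terms and \<open>\<bar>\<gamma> k\<bar> \<ge> g\<close>. So the graph points \<open>(y k, w k)\<close> with \<open>k \<ge> N\<close> form a monotone set to which \<open>bounded_monotone_set_zero\<close>
  applies. From \<open>N\<close> on the orbit cannot distinguish its point \<open>p\<close> from a zero of \<open>A\<close>: the decrease estimate
  holds around \<open>p\<close>, and it forces the residuals \<open>x k - y k\<close> to be arbitrarily small infinitely
  often. As \<open>c\<close> is bounded away from zero, the corresponding \<open>w k\<close> tend to zero, and
  \<open>zer_if_approximate_zeros\<close> produces a genuine zero.
\<close>

lemma zer_if_bounded: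
  fixes A :: "'a::{real_inner, banach} \<Rightarrow> 'a set" and x e :: "nat \<Rightarrow> 'a"
  assumes A: "maximally_monotone A"
    and c: "c0 > 0" "\<And>k. c0 \<le> c k"
    and x_Suc: "\<And>k. x (Suc k) =
      \<alpha> k *\<^sub>R u + \<beta> k *\<^sub>R x k + \<gamma> k *\<^sub>R resolvent (c k) A (x k) + \<delta> k *\<^sub>R e k"
    and coeffs: "\<And>k. \<bar>\<beta> k + \<gamma> k / 2\<bar> + \<bar>\<gamma> k / 2\<bar> \<le> 1"
    and sum_\<alpha>: "summable (\<lambda>k. \<bar>\<alpha> k\<bar>)"
    and sum_\<beta>\<gamma>: "summable (\<lambda>k. \<bar>1 - \<beta> k - \<gamma> k\<bar>)"
    and sum_e: "summable (\<lambda>k. norm (\<delta> k *\<^sub>R e k))"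
    and \<gamma>: "g > 0" "\<forall>\<^sub>F k in sequentially. g \<le> \<bar>\<gamma> k\<bar>"
    and sgn: "\<forall>\<^sub>F k in sequentially. \<gamma> k * (\<beta> k + \<gamma> k) \<ge> 0"
    and \<theta>: "\<forall>\<^sub>F k in sequentially. \<gamma> k * (2 * \<beta> k + \<gamma> k) \<ge> 0"
    and diverge: "filterlim (\<lambda>n. \<Sum>k<n. \<gamma> k * (2 * \<beta> k + \<gamma> k)) at_top sequentially"
    and bounded: "bounded (range x)"
  shows "zer A \<noteq> {}"
proof -
  define y where "y k = resolvent (c k) A (x k)" for k
  define w where "w k = (1 / c k) *\<^sub>R (x k - y k)" for k
  have c_pos: "c k > 0" for k using c(1) c(2)[of k] by linarith
  have w: "w k \<in> A (y k)" for k
    unfolding w_def y_def using resolvent_mem[OF A c_pos] .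
  obtain K where K: "\<And>k. norm (x k) \<le> K" using bounded by (auto simp: bounded_iff)
  have "\<forall>\<^sub>F k in sequentially. g \<le> \<bar>\<gamma> k\<bar> \<and> \<gamma> k * (\<beta> k + \<gamma> k) \<ge> 0 \<and> \<gamma> k * (2 * \<beta> k + \<gamma> k) \<ge> 0"
    using \<gamma>(2) sgn \<theta> by eventually_elim auto
  then obtain N where N: "\<And>k. k \<ge> N \<Longrightarrow> g \<le> \<bar>\<gamma> k\<bar>"
      "\<And>k. k \<ge> N \<Longrightarrow> \<gamma> k * (\<beta> k + \<gamma> k) \<ge> 0" "\<And>k. k \<ge> N \<Longrightarrow> \<gamma> k * (2 * \<beta> k + \<gamma> k) \<ge> 0"
    by (auto simp: eventually_sequentially)
  \<comment> \<open>\<open>\<beta> k\<close> and \<open>\<beta> k + \<gamma> k\<close> are the difference and the sum of \<open>\<beta> k + \<gamma> k / 2\<close> and \<open>\<gamma> k / 2\<close>.\<close>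
  have \<beta>: "\<bar>\<beta> k\<bar> \<le> 1" for k using coeffs[of k] by argo
  have \<beta>\<gamma>: "\<bar>\<beta> k + \<gamma> k\<bar> \<le> 1" for k using coeffs[of k] by argo
  define M where "M = 2 * K + suminf (\<lambda>k. \<bar>\<alpha> k\<bar>) * norm u + suminf (\<lambda>k. norm (\<delta> k *\<^sub>R e k))"
  have y_bound: "norm (y k) \<le> M / g" if "k \<ge> N" for k
  proof -
    have "\<bar>\<alpha> k\<bar> \<le> suminf (\<lambda>k. \<bar>\<alpha> k\<bar>)" "norm (\<delta> k *\<^sub>R e k) \<le> suminf (\<lambda>k. norm (\<delta> k *\<^sub>R e k))"
      using sum_le_suminf[OF sum_\<alpha>, of "{k}"] sum_le_suminf[OF sum_e, of "{k}"] by auto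
    moreover have "\<bar>\<alpha> k\<bar> * norm u \<le> suminf (\<lambda>k. \<bar>\<alpha> k\<bar>) * norm u"
      using calculation by (intro mult_right_mono) auto
    moreover have "\<bar>\<beta> k\<bar> * norm (x k) \<le> 1 * K"
      using \<beta>[of k] K[of k] by (intro mult_mono) auto
    moreover have "\<gamma> k *\<^sub>R y k = x (Suc k) - \<alpha> k *\<^sub>R u - \<beta> k *\<^sub>R x k - \<delta> k *\<^sub>R e k"
      unfolding x_Suc y_def by simp
    then have "norm (\<gamma> k *\<^sub>R y k)
        \<le> norm (x (Suc k)) + norm (\<alpha> k *\<^sub>R u) + norm (\<beta> k *\<^sub>R x k) + norm (\<delta> k *\<^sub>R e k)"
      using norm_triangle4_minus by metis
    then have "\<bar>\<gamma> k\<bar> * norm (y k)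
        \<le> norm (x (Suc k)) + \<bar>\<alpha> k\<bar> * norm u + \<bar>\<beta> k\<bar> * norm (x k) + norm (\<delta> k *\<^sub>R e k)"
      by simp
    ultimately have "\<bar>\<gamma> k\<bar> * norm (y k) \<le> M"
      using K[of "Suc k"] unfolding M_def by linarith
    moreover have "g * norm (y k) \<le> \<bar>\<gamma> k\<bar> * norm (y k)"
      using N(1)[OF that] by (intro mult_right_mono) auto
    ultimately show ?thesis using \<gamma>(1) by (simp add: field_simps)
  qed
  define S where "S = (\<lambda>k. (y k, w k)) ` {N..}"
  have S_mono: "(z - z') \<bullet> (v - v') \<ge> 0" if "(z, v) \<in> S" "(z', v') \<in> S" for z v z' v'
    using that w maximally_monotoneD[OF A] unfolding S_def by auto
  have "bounded (fst ` S)"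
    using y_bound unfolding S_def by (auto simp: bounded_iff)
  then obtain p where p: "\<And>z v. (z, v) \<in> S \<Longrightarrow> (z - p) \<bullet> v \<ge> 0"
    using bounded_monotone_set_zero[of S, OF S_mono] by blast
  have firm: "(y k - p) \<bullet> ((x k - p) - (y k - p)) \<ge> 0" if "k \<ge> N" for k
  proof -
    have "(y k - p) \<bullet> w k \<ge> 0" using p that unfolding S_def by blast
    then show ?thesis using c_pos[of k] unfolding w_def by (simp add: zero_le_mult_iff zero_le_divide_iff)
  qed
  define err where "err k = \<bar>\<alpha> k\<bar> * norm u + \<bar>1 - \<beta> k - \<gamma> k\<bar> * norm p + norm (\<delta> k *\<^sub>R e k)" for k
  have ex: "\<exists>k. k \<ge> N \<and> norm ((x k - p) - (y k - p)) < 1 / Suc n" for n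
  proof (rule residual_small_if_weights_diverge[where \<epsilon> = err and N = N and \<eta> = "1 / Suc n"
        and a = "\<lambda>k. norm (x k - p)" and K = "K + norm p"
        and b = "\<lambda>k. norm (\<beta> k *\<^sub>R (x k - p) + \<gamma> k *\<^sub>R (y k - p))"
        and r = "\<lambda>k. norm ((x k - p) - (y k - p))" and \<theta> = "\<lambda>k. \<gamma> k * (2 * \<beta> k + \<gamma> k)"])
    show "norm (x k - p) \<le> K + norm p" for k
      using norm_triangle_ineq4[of "x k" p] K[of k] by linarith
    show "summable err"
      unfolding err_def by (intro summable_add summable_mult2 sum_\<alpha> sum_\<beta>\<gamma> sum_e)
    show "norm (x (Suc k) - p) \<le> norm (\<beta> k *\<^sub>R (x k - p) + \<gamma> k *\<^sub>R (y k - p)) + err k" for k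
      unfolding err_def y_def by (rule perturbed_step_dist[OF x_Suc])
  qed (use N diverge relaxed_step_decrease[OF firm N(2) \<beta>\<gamma>] in \<open>auto simp: err_def\<close>)
  then obtain \<kappa> where \<kappa>: "\<And>n. \<kappa> n \<ge> N" "\<And>n. norm (x (\<kappa> n) - y (\<kappa> n)) < 1 / Suc n"
    by simp metis
  show ?thesis
  proof (rule zer_if_approximate_zeros[OF A, of "\<lambda>n. w (\<kappa> n)" "\<lambda>n. y (\<kappa> n)"])
    show "w (\<kappa> n) \<in> A (y (\<kappa> n))" for n by (rule w)
    show "bounded (range (\<lambda>n. y (\<kappa> n)))"
      using y_bound \<kappa>(1) by (auto simp: bounded_iff)
    have "norm (w (\<kappa> n)) \<le> norm (1 / real (Suc n)) * (1 / c0)" for n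
    proof -
      have "norm (w (\<kappa> n)) = norm (x (\<kappa> n) - y (\<kappa> n)) * (1 / c (\<kappa> n))"
        unfolding w_def using c_pos[of "\<kappa> n"] by simp
      also have "\<dots> \<le> (1 / Suc n) * (1 / c0)"
        using \<kappa>(2)[of n] c(1) c(2)[of "\<kappa> n"] c_pos[of "\<kappa> n"]
        by (intro mult_mono) (auto intro: divide_left_mono)
      finally show ?thesis by simp
    qed
    then show "(\<lambda>n. w (\<kappa> n)) \<longlonglongrightarrow> 0"
      by (intro tendsto_0_le[OF LIMSEQ_Suc[OF lim_1_over_n], of _ "1 / c0"] always_eventually allI)
  qed
qed

text \<open>
  For a zero \<open>p\<close> of \<open>A\<close>, monotonicity between \<open>(p, 0)\<close> and the graph point of the resolvent is
  the hypothesis of \<open>relaxed_step_nonexpansive\<close>, so the distance to \<open>p\<close> grows at most by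
  the summable perturbations.
\<close>

lemma bounded_if_zer:
  fixes A :: "'a::{real_inner, banach} \<Rightarrow> 'a set" and x e :: "nat \<Rightarrow> 'a"
  assumes A: "maximally_monotone A"
    and c_pos: "\<And>k. c k > 0"
    and x_Suc: "\<And>k. x (Suc k) =
      \<alpha> k *\<^sub>R u + \<beta> k *\<^sub>R x k + \<gamma> k *\<^sub>R resolvent (c k) A (x k) + \<delta> k *\<^sub>R e k"
    and coeffs: "\<And>k. \<bar>\<beta> k + \<gamma> k / 2\<bar> + \<bar>\<gamma> k / 2\<bar> \<le> 1"
    and sum_\<alpha>: "summable (\<lambda>k. \<bar>\<alpha> k\<bar>)"
    and sum_\<beta>\<gamma>: "summable (\<lambda>k. \<bar>1 - \<beta> k - \<gamma> k\<bar>)"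
    and sum_e: "summable (\<lambda>k. norm (\<delta> k *\<^sub>R e k))"
    and zer: "zer A \<noteq> {}"
  shows "bounded (range x)"
proof -
  obtain p where p: "0 \<in> A p" using zer by (auto simp: zer_def)
  define y where "y k = resolvent (c k) A (x k)" for k
  define err where "err k = \<bar>\<alpha> k\<bar> * norm u + \<bar>1 - \<beta> k - \<gamma> k\<bar> * norm p + norm (\<delta> k *\<^sub>R e k)" for k
  have firm: "(y k - p) \<bullet> ((x k - p) - (y k - p)) \<ge> 0" for k
  proof -
    have "(y k - p) \<bullet> ((1 / c k) *\<^sub>R (x k - y k) - 0) \<ge> 0"
      unfolding y_def using maximally_monotoneD[OF A resolvent_mem[OF A c_pos] p] .
    then show ?thesis using c_pos[of k] by (simp add: zero_le_mult_iff zero_le_divide_iff)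
  qed
  show ?thesis
  proof (rule bounded_if_quasi_Fejer)
    fix k
    have "norm (x (Suc k) - p) \<le> norm (\<beta> k *\<^sub>R (x k - p) + \<gamma> k *\<^sub>R (y k - p)) + err k"
      unfolding err_def y_def by (rule perturbed_step_dist[OF x_Suc])
    also have "\<dots> \<le> norm (x k - p) + err k"
      using relaxed_step_nonexpansive[OF firm coeffs] by simp
    finally show "norm (x (Suc k) - p) \<le> norm (x k - p) + err k" .
    show "err k \<ge> 0" unfolding err_def by simp
  next
    show "summable err"
      unfolding err_def by (intro summable_add summable_mult2 sum_\<alpha> sum_\<beta>\<gamma> sum_e)
  qed
qed

text \<open>
  The three alternatives share the features needed for \<open>zer_if_bounded\<close>: \<open>c\<close> is bounded away from
  zero, and eventually \<open>\<bar>\<gamma> k\<bar>\<close> is bounded away from zero, \<open>\<gamma> k (\<beta> k + \<gamma> k)\<close> and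
  \<open>\<gamma> k (2 \<beta> k + \<gamma> k)\<close> are nonnegative, and the latter have a divergent sum. In the first
  alternative \<open>\<beta> k + \<gamma> k\<close> and \<open>\<gamma> k\<close> tend to \<open>1\<close>, hence so do both products.
\<close>

theorem theorem3p11:
  fixes A :: "'a::{real_inner, banach} \<Rightarrow> 'a set"
    and u x0 :: 'a
    and e x :: "nat \<Rightarrow> 'a"
    and c \<alpha> \<beta> \<gamma> \<delta> :: "nat \<Rightarrow> real"
  assumes nontrivial: "(UNIV :: 'a set) \<noteq> {0}"
    and A: "maximally_monotone A"
    and c_pos: "\<And>k. c k > 0"
    and x_0: "x 0 = x0"
    and x_Suc: "\<And>k. x (Suc k) =
      \<alpha> k *\<^sub>R u + \<beta> k *\<^sub>R x k + \<gamma> k *\<^sub>R resolvent (c k) A (x k) + \<delta> k *\<^sub>R e k"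
    and coeffs: "\<And>k. \<bar>\<beta> k + \<gamma> k / 2\<bar> + \<bar>\<gamma> k / 2\<bar> \<le> 1"
    and sum_\<alpha>: "summable (\<lambda>k. \<bar>\<alpha> k\<bar>)"
    and sum_\<beta>\<gamma>: "summable (\<lambda>k. \<bar>1 - \<beta> k - \<gamma> k\<bar>)"
    and sum_e: "summable (\<lambda>k. norm (\<delta> k *\<^sub>R e k))"
    and cases:
      "(\<gamma> \<longlonglongrightarrow> 1 \<and> ((INF k. c k) > 0 \<or> filterlim c at_top sequentially))
       \<or>
       ((\<forall>k. \<gamma> k * (\<beta> k + \<gamma> k) \<ge> 0) \<and>
        liminf (\<lambda>k. ereal (\<gamma> k * (2 * \<beta> k + \<gamma> k))) > 0 \<and>
        ((INF k. c k) > 0 \<or> filterlim c at_top sequentially) \<and>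
        liminf (\<lambda>k. ereal \<bar>\<gamma> k\<bar>) > 0 \<and>
        (SUP k. ereal \<bar>\<beta> k\<bar>) < \<infinity>)
       \<or>
       ((\<forall>k. \<gamma> k * (\<beta> k + \<gamma> k) \<ge> 0 \<and>
             \<gamma> k * (2 * \<beta> k + \<gamma> k) \<ge> 0 \<and>
             \<bar>\<beta> k + \<gamma> k\<bar> * \<bar>\<gamma> k\<bar> \<le> max (1 - \<bar>\<beta> k\<bar>) (2 - 2 * \<bar>\<beta> k + \<gamma> k / 2\<bar>)) \<and>
        filterlim (\<lambda>n. \<Sum>k<n. \<gamma> k * (2 * \<beta> k + \<gamma> k)) at_top sequentially \<and>
        (INF k. c k) > 0 \<and>
        summable (\<lambda>k. \<bar>c (Suc k) - c k\<bar>) \<and>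
        liminf (\<lambda>k. ereal \<bar>\<gamma> k\<bar>) > 0 \<and>
        (SUP k. ereal \<bar>\<beta> k\<bar>) < \<infinity>)"
  shows "zer A \<noteq> {} \<longleftrightarrow> bounded (range x)"
proof
  assume "zer A \<noteq> {}"
  then show "bounded (range x)"
    using bounded_if_zer[OF A c_pos x_Suc coeffs sum_\<alpha> sum_\<beta>\<gamma> sum_e] by blast
next
  assume bounded: "bounded (range x)"
  let ?\<theta> = "\<lambda>k. \<gamma> k * (2 * \<beta> k + \<gamma> k)"
  have c: "(INF k. c k) > 0 \<or> filterlim c at_top sequentially"
    using cases by blast
  obtain c0 where c0: "c0 > 0" "\<And>k. c0 \<le> c k"
    using bounded_below_pos[of c, OF c_pos c] by blast
  have weights: "(\<exists>g>0. \<forall>\<^sub>F k in sequentially. g \<le> \<bar>\<gamma> k\<bar>) \<and>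
    (\<forall>\<^sub>F k in sequentially. \<gamma> k * (\<beta> k + \<gamma> k) \<ge> 0) \<and>
    (\<forall>\<^sub>F k in sequentially. ?\<theta> k \<ge> 0) \<and>
    filterlim (\<lambda>n. \<Sum>k<n. ?\<theta> k) at_top sequentially"
    using cases
  proof (elim disjE)
    assume "\<gamma> \<longlonglongrightarrow> 1 \<and> ((INF k. c k) > 0 \<or> filterlim c at_top sequentially)"
    then have \<gamma>: "\<gamma> \<longlonglongrightarrow> 1" by blast
    have "(\<lambda>k. 1 - \<beta> k - \<gamma> k) \<longlonglongrightarrow> 0"
      using summable_LIMSEQ_zero[OF sum_\<beta>\<gamma>] tendsto_rabs_zero_iff by blast
    from tendsto_diff[OF tendsto_const[of 1] this]
    have \<beta>\<gamma>: "(\<lambda>k. \<beta> k + \<gamma> k) \<longlonglongrightarrow> 1" by simp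
    have "(\<lambda>k. \<gamma> k * (\<beta> k + \<gamma> k)) \<longlonglongrightarrow> 1"
      using tendsto_mult[OF \<gamma> \<beta>\<gamma>] by simp
    from eventually_ge_half[OF this]
    have 1: "\<forall>\<^sub>F k in sequentially. \<gamma> k * (\<beta> k + \<gamma> k) \<ge> 0" by eventually_elim simp
    have "?\<theta> \<longlonglongrightarrow> 1 * (2 * 1 - 1)"
    proof -
      have eq: "?\<theta> k = \<gamma> k * (2 * (\<beta> k + \<gamma> k) - \<gamma> k)" for k by (simp add: algebra_simps)
      show ?thesis unfolding eq by (intro tendsto_intros \<gamma> \<beta>\<gamma>)
    qed
    then have half: "\<forall>\<^sub>F k in sequentially. 1 / 2 \<le> ?\<theta> k"
      using eventually_ge_half by simp
    then have 2: "\<forall>\<^sub>F k in sequentially. ?\<theta> k \<ge> 0" by eventually_elim simp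
    from eventually_ge_half[OF \<gamma>]
    have 3: "\<forall>\<^sub>F k in sequentially. 1 / 2 \<le> \<bar>\<gamma> k\<bar>" by eventually_elim simp
    have "\<exists>g>0. \<forall>\<^sub>F k in sequentially. g \<le> \<bar>\<gamma> k\<bar>"
      using 3 by (intro exI[of _ "1 / 2"]) simp
    then show ?thesis using 1 2 sum_at_top_if_eventually_ge[OF _ half] by simp
  next
    assume *: "(\<forall>k. \<gamma> k * (\<beta> k + \<gamma> k) \<ge> 0) \<and>
        liminf (\<lambda>k. ereal (?\<theta> k)) > 0 \<and>
        ((INF k. c k) > 0 \<or> filterlim c at_top sequentially) \<and>
        liminf (\<lambda>k. ereal \<bar>\<gamma> k\<bar>) > 0 \<and>
        (SUP k. ereal \<bar>\<beta> k\<bar>) < \<infinity>"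
    obtain \<eta> where \<eta>: "\<eta> > 0" "\<forall>\<^sub>F k in sequentially. \<eta> \<le> ?\<theta> k"
      using * liminf_ereal_pos[of ?\<theta>] by blast
    from \<eta>(2) have "\<forall>\<^sub>F k in sequentially. ?\<theta> k \<ge> 0"
      by eventually_elim (use \<eta>(1) in linarith)
    moreover have "\<exists>g>0. \<forall>\<^sub>F k in sequentially. g \<le> \<bar>\<gamma> k\<bar>"
      using * liminf_ereal_pos[of "\<lambda>k. \<bar>\<gamma> k\<bar>"] by blast
    ultimately show ?thesis
      using * sum_at_top_if_eventually_ge[OF \<eta>] by simp
  next
    assume *: "(\<forall>k. \<gamma> k * (\<beta> k + \<gamma> k) \<ge> 0 \<and>
             ?\<theta> k \<ge> 0 \<and>
             \<bar>\<beta> k + \<gamma> k\<bar> * \<bar>\<gamma> k\<bar> \<le> max (1 - \<bar>\<beta> k\<bar>) (2 - 2 * \<bar>\<beta> k + \<gamma> k / 2\<bar>)) \<and>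
        filterlim (\<lambda>n. \<Sum>k<n. ?\<theta> k) at_top sequentially \<and>
        (INF k. c k) > 0 \<and>
        summable (\<lambda>k. \<bar>c (Suc k) - c k\<bar>) \<and>
        liminf (\<lambda>k. ereal \<bar>\<gamma> k\<bar>) > 0 \<and>
        (SUP k. ereal \<bar>\<beta> k\<bar>) < \<infinity>"
    have "\<exists>g>0. \<forall>\<^sub>F k in sequentially. g \<le> \<bar>\<gamma> k\<bar>"
      using * liminf_ereal_pos[of "\<lambda>k. \<bar>\<gamma> k\<bar>"] by blast
    then show ?thesis using * by simp
  qed
  then obtain g where "g > 0" "\<forall>\<^sub>F k in sequentially. g \<le> \<bar>\<gamma> k\<bar>" by blast
  then show "zer A \<noteq> {}"
    using zer_if_bounded[OF A c0 x_Suc coeffs sum_\<alpha> sum_\<beta>\<gamma> sum_e] weights bounded by blast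
qed

end
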